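(* Let $(\psi,\mathcal X,\mathcal Y,\mathcal U,\mathcal P,\|\cdot\|,r)$ be any dual-extraction setup (defined in the context), and suppose for some $x\in\mathcal X$ that $-\psi(x,\cdot)$ is $\mu$-strongly convex over $\mathcal Y\cap\operatorname{int}\mathcal P$ relative to $r$ for some $\mu>0$. Let $f(x'):=\max_{y\in\mathcal Y}\psi(x',y)$, $\phi(y):=\min_{x'\in\mathcal X}\psi(x',y)$, $x^\star\in\operatorname{argmin}_{x'\in\mathcal X}f(x')$ and $y^\star\in\operatorname{argmax}_{y\in\mathcal Y}\phi(y)$. Then, letting $y_x:=\operatorname{argmax}_{y\in\mathcal Y}\psi(x,y)$, we have $$V_{y_x}(y^\star)\le\frac{f(x)-f(x^\star)}{\mu}.$$
   Context: Dgf setup. $(\mathcal U,\mathcal P,\|\cdot\|,r)$ is a dgf setup over $\mathbb R^n$ if $\mathcal U\subseteq\mathcal P\subseteq\mathbb R^n$ are closed convex sets with $\mathcal U\cap\operatorname{int}\mathcal P\ne\emptyset$, $\|\cdot\|$ is a norm on $\mathbb R^n$, and: (i) $r:\mathcal P\to\mathbb R$ is convex and continuous on $\mathcal P$, differentiable on $\operatorname{int}\mathcal P$, and $\mu_r$-strongly convex with respect to $\|\cdot\|$ on $\mathcal U\cap\operatorname{int}\mathcal P$ for some $\mu_r>0$; (ii) either $\lim_{u\to\operatorname{bd}\mathcal P}\|\nabla r(u)\|_2=\infty$ or $\mathcal U\subseteq\operatorname{int}\mathcal P$. Its Bregman divergence is $V_u(v):=r(v)-r(u)-\langle\nabla r(u),v-u\rangle$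 for $u\in\operatorname{int}\mathcal P$, $v\in\mathcal P$. Dual-extraction setup. A tuple $(\psi,\mathcal X,\mathcal Y,\mathcal U,\mathcal P,\|\cdot\|,r)$ with $\psi:\mathbb R^d\times\mathbb R^n\to\mathbb R$ such that: (i) $\psi(x,\cdot)$ is differentiable for every $x$; (ii) $\psi(\cdot,y)$ is convex for every $y$ and $\psi(x,\cdot)$ is concave for every $x$; (iii) $(\mathcal U,\mathcal P,\|\cdot\|,r)$ is a dgf setup over $\mathbb R^n$; (iv) $\mathcal X\subseteq\mathbb R^d$ and $\mathcal Y\subseteq\mathbb R^n$ are nonempty, closed, convex, with $\mathcal Y\subseteq\mathcal U$ and $\mathcal Y\cap\operatorname{int}\mathcal P\neq\emptyset$; (v) $\mathcal X$ is bounded or $\psi(\cdot,y)$ is strongly convex for every $y$; (vi) $\mathcal Y$ is bounded or $\psi(x,\cdot)$ is strongly concave for every $x$; (vii) for all $p\in\mathcal U\cap\operatorname{int}\mathcal P$ and all $w\in\partial\mathbb I_{\mathcal U}(p)$ (with $\mathbb I_{\mathcal U}$ the $0/\infty$ indicator of $\mathcal U$), the map $y\mapsto\langle w,y\rangle$ is constant over $\mathcal Y$. Relative strong convexity: a differentiable $g$ is $\mu$-strongly convex relative to $r$ over a set $S$ if $g(v)-g(u)-\langle\nabla g(u),v-u\rangle\ge\mu\,(r(v)-r(u)-\langle\nabla r(u),v-u\rangle)$ for all $u,v\in S$. *)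

theory Defs
  imports "HOL-Analysis.Analysis"
begin

definition is_norm :: "('a::real_vector \<Rightarrow> real) \<Rightarrow> bool" where
  "is_norm N \<longleftrightarrow>
     (\<forall>v. N v = 0 \<longleftrightarrow> v = 0) \<and>
     (\<forall>c v. N (c *\<^sub>R v) = \<bar>c\<bar> * N v) \<and>
     (\<forall>v w. N (v + w) \<le> N v + N w)"

text \<open>Only meaningful at points where \<open>f\<close> is differentiable.\<close>

definition grad :: "('a::real_inner \<Rightarrow> real) \<Rightarrow> 'a \<Rightarrow> 'a" where
  "grad f u = (THE g. GDERIV f u :> g)"

definition bregman :: "('a::real_inner \<Rightarrow> real) \<Rightarrow> 'a \<Rightarrow> 'a \<Rightarrow> real" where
  "bregman r u v = r v - r u - grad r u \<bullet> (v - u)"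

text \<open>Strong convexity with modulus \<open>m\<close> with respect to the norm \<open>N\<close>, in the form
  that does not require differentiability.\<close>

definition strongly_convex_on ::
  "('a::real_vector \<Rightarrow> real) \<Rightarrow> real \<Rightarrow> 'a set \<Rightarrow> ('a \<Rightarrow> real) \<Rightarrow> bool" where
  "strongly_convex_on N m S f \<longleftrightarrow> convex S \<and>
     (\<forall>u\<in>S. \<forall>v\<in>S. \<forall>t\<in>{0..1}.
        f ((1 - t) *\<^sub>R u + t *\<^sub>R v)
          \<le> (1 - t) * f u + t * f v - m / 2 * t * (1 - t) * (N (v - u))\<^sup>2)"

definition rel_strongly_convex_on ::
  "('a::real_inner \<Rightarrow> real) \<Rightarrow> real \<Rightarrow> 'a set \<Rightarrow> ('a \<Rightarrow> real) \<Rightarrow> bool" where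
  "rel_strongly_convex_on r m S g \<longleftrightarrow>
     (\<forall>u\<in>S. \<forall>v\<in>S. g v - g u - grad g u \<bullet> (v - u)
        \<ge> m * (r v - r u - grad r u \<bullet> (v - u)))"

definition convex_indicator :: "'a set \<Rightarrow> 'a \<Rightarrow> ereal" where
  "convex_indicator S u = (if u \<in> S then 0 else \<infinity>)"

definition subdifferential :: "('a::real_inner \<Rightarrow> ereal) \<Rightarrow> 'a \<Rightarrow> 'a set" where
  "subdifferential h p = {w. \<forall>z. h p + ereal (w \<bullet> (z - p)) \<le> h z}"

text \<open>The function \<open>r\<close> is total, but only its values on \<open>P\<close> are constrained or used.
  In \<open>steep\<close>, the limit is taken from within \<open>interior P\<close> at each point of the
  boundary separately, without uniformity over the boundary.\<close>

locale dgf_setup =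
  fixes U P :: "(real ^ 'n) set"
    and N :: "real ^ 'n \<Rightarrow> real"
    and r :: "real ^ 'n \<Rightarrow> real"
  assumes U_subset_P: "U \<subseteq> P"
    and closed_U: "closed U" and convex_U: "convex U"
    and closed_P: "closed P" and convex_P: "convex P"
    and U_int_P: "U \<inter> interior P \<noteq> {}"
    and is_norm_N: "is_norm N"
    and convex_r: "convex_on P r"
    and continuous_r: "continuous_on P r"
    and differentiable_r: "\<And>u. u \<in> interior P \<Longrightarrow> r differentiable (at u)"
    and strongly_convex_r: "\<exists>m>0. strongly_convex_on N m (U \<inter> interior P) r"
    and steep:
      "(\<forall>b\<in>frontier P. filterlim (\<lambda>u. norm (grad r u)) at_top (at b within interior P))
       \<or> U \<subseteq> interior P"

locale dual_extraction_setup = dgf_setup U P N r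
  for \<psi> :: "real ^ 'd \<Rightarrow> real ^ 'n \<Rightarrow> real"
    and X :: "(real ^ 'd) set"
    and Y U P :: "(real ^ 'n) set"
    and N :: "real ^ 'n \<Rightarrow> real"
    and r :: "real ^ 'n \<Rightarrow> real" +
  assumes differentiable_psi: "\<And>x y. \<psi> x differentiable (at y)"
    and convex_psi: "\<And>y. convex_on UNIV (\<lambda>x. \<psi> x y)"
    and concave_psi: "\<And>x. concave_on UNIV (\<psi> x)"
    and X_nonempty: "X \<noteq> {}" and closed_X: "closed X" and convex_X: "convex X"
    and Y_nonempty: "Y \<noteq> {}" and closed_Y: "closed Y" and convex_Y: "convex Y"
    and Y_subset_U: "Y \<subseteq> U"
    and Y_int_P: "Y \<inter> interior P \<noteq> {}"
    and bounded_X_or: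
      "bounded X \<or> (\<forall>y. \<exists>m>0. strongly_convex_on norm m UNIV (\<lambda>x. \<psi> x y))"
    and bounded_Y_or:
      "bounded Y \<or> (\<forall>x. \<exists>m>0. strongly_convex_on norm m UNIV (\<lambda>y. - \<psi> x y))"
    and normals_constant:
      "\<And>p w. p \<in> U \<inter> interior P \<Longrightarrow> w \<in> subdifferential (convex_indicator U) p
        \<Longrightarrow> (\<lambda>y. w \<bullet> y) constant_on Y"

text \<open>In a \<open>dual_extraction_setup\<close>, \<open>bounded_Y_or\<close> and \<open>bounded_X_or\<close> make the supremum
  and the infimum below attained, so they are a maximum and a minimum.\<close>

definition primal_fun :: "('a \<Rightarrow> 'b \<Rightarrow> real) \<Rightarrow> 'b set \<Rightarrow> 'a \<Rightarrow> real" where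
  "primal_fun \<psi> Y x = (SUP y\<in>Y. \<psi> x y)"

definition dual_fun :: "('a \<Rightarrow> 'b \<Rightarrow> real) \<Rightarrow> 'a set \<Rightarrow> 'b \<Rightarrow> real" where
  "dual_fun \<psi> X y = (INF x\<in>X. \<psi> x y)"

end

theory Submission
  imports Defs
begin

text \<open>
  Write \<open>g = - \<psi> x\<close>, a differentiable convex function, and let \<open>y\<close> be a minimiser of \<open>g\<close>
  over \<open>Y\<close>. If \<open>y\<close> is interior to \<open>P\<close>, relative strong convexity at \<open>y\<close> and the first-order
  condition \<open>grad g y \<bullet> (v - y) \<ge> 0\<close> give \<open>\<mu> * bregman r y v \<le> \<psi> x y - \<psi> x v\<close> for every \<open>v\<close>
  in \<open>Y\<close> interior to \<open>P\<close> (\<open>argmax_relative_growth\<close>). For a second maximiser \<open>v\<close> the right-hand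
  side vanishes whereas strong convexity of \<open>r\<close> makes the left-hand side positive, so \<open>y\<close> is unique.
  For \<open>v = y_star\<close> the right-hand side is at most the duality gap \<open>f x - \<phi> y_star\<close>, and
  \<open>\<phi> y_star \<ge> f x_star\<close> by strong duality. Two points carry the argument.

  Interiority: in fact all of \<open>Y\<close> lies in \<open>interior P\<close> (\<open>feasible_set_subset_interior\<close>).
  On the segment from a point of \<open>Y\<close> on the frontier of \<open>P\<close> to a point of \<open>Y\<close> in the interior,
  \<open>\<mu> * bregman r\<close> is dominated by the Bregman divergence of \<open>g\<close>, which stays bounded because \<open>g\<close>
  is differentiable up to the frontier point. This bounds \<open>grad r\<close> along the segment
  (\<open>grad_bounded_along_segment\<close>) and contradicts steepness, the case \<open>U \<subseteq> interior P\<close> being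
  immediate.

  Strong duality (\<open>strong_duality\<close>): if \<open>\<psi>\<close> is strongly convex in \<open>x\<close>, the minimiser \<open>xs\<close> for the
  dual optimum \<open>ys\<close> is stable under perturbation of \<open>ys\<close>; moving \<open>ys\<close> slightly towards any \<open>y\<close> and
  using optimality of \<open>ys\<close> yields \<open>\<psi> xs y \<le> \<phi> ys\<close> (\<open>saddle_of_strongly_convex\<close>).
  If instead \<open>X\<close> is bounded, the same argument applies to \<open>\<psi> x y + e * (norm x)\<^sup>2\<close>, a perturbation
  that vanishes uniformly on \<open>X\<close> as \<open>e\<close> tends to \<open>0\<close>.
\<close>

section \<open>Gradients and first-order conditions\<close>

lemma gderiv_grad:
  fixes f :: "'a::euclidean_space \<Rightarrow> real"
  assumes "f differentiable (at u)"
  shows "GDERIV f u :> grad f u"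
proof -
  obtain f' where f': "(f has_derivative f') (at u)"
    using assms by (auto simp: differentiable_def)
  interpret f': bounded_linear f' using f' by (rule has_derivative_bounded_linear)
  define g where "g = (\<Sum>b\<in>Basis. f' b *\<^sub>R b)"
  have "f' h = h \<bullet> g" for h
  proof -
    have "f' h = f' (\<Sum>b\<in>Basis. (h \<bullet> b) *\<^sub>R b)" by (simp add: euclidean_representation)
    also have "\<dots> = h \<bullet> g"
      by (simp add: f'.sum f'.scaleR g_def inner_sum_right mult.commute)
    finally show ?thesis .
  qed
  then have "f' = (\<lambda>h. h \<bullet> g)" by blast
  then have g: "GDERIV f u :> g" using f' by (simp add: gderiv_def)
  have "g' = g" if "GDERIV f u :> g'" for g'
  proof -
    have "(\<lambda>h. h \<bullet> g') = (\<lambda>h. h \<bullet> g)"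
      using g that has_derivative_unique unfolding gderiv_def by blast
    then have "\<forall>h. h \<bullet> g' = h \<bullet> g" by (auto dest: fun_cong)
    then show ?thesis by (simp only: vector_eq_ldot)
  qed
  then show ?thesis
    unfolding grad_def by (rule theI[where P = "\<lambda>g. GDERIV f u :> g", OF g])
qed

lemma directional_derivative:
  fixes f :: "'a::euclidean_space \<Rightarrow> real"
  assumes "f differentiable (at u)"
  shows "((\<lambda>t. (f (u + t *\<^sub>R h) - f u) / t) \<longlongrightarrow> grad f u \<bullet> h) (at_right 0)"
proof -
  have 1: "(f has_derivative (\<lambda>k. k \<bullet> grad f u)) (at (u + 0 *\<^sub>R h))"
    using gderiv_grad[OF assms] by (simp add: gderiv_def)
  have 2: "((\<lambda>t. u + t *\<^sub>R h) has_derivative (\<lambda>t. t *\<^sub>R h)) (at (0::real))"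
    by (auto intro!: derivative_eq_intros)
  have "((\<lambda>t. f (u + t *\<^sub>R h)) has_derivative (\<lambda>t. (t *\<^sub>R h) \<bullet> grad f u)) (at 0)"
    using has_derivative_compose[OF 2 1] .
  moreover have "(\<lambda>t. (t *\<^sub>R h) \<bullet> grad f u) = (*) (grad f u \<bullet> h)"
    by (auto simp: inner_commute fun_eq_iff)
  ultimately have "((\<lambda>t. f (u + t *\<^sub>R h)) has_field_derivative grad f u \<bullet> h) (at 0)"
    by (simp only: has_field_derivative_def)
  then have "((\<lambda>t. (f (u + t *\<^sub>R h) - f u) / t) \<longlongrightarrow> grad f u \<bullet> h) (at 0)"
    by (simp add: has_field_derivative_iff)
  then show ?thesis by (rule tendsto_within_subset[OF _ subset_UNIV])
qed

lemma eventually_at_right_unit: "\<forall>\<^sub>F t in at_right (0::real). 0 < t \<and> t < 1"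
  by (rule eventually_mono[OF eventually_at_right_real[of 0 1]]) auto

lemma convex_gradient_inequality:
  fixes f :: "'a::euclidean_space \<Rightarrow> real"
  assumes cvx: "convex_on S f" and diff: "f differentiable (at u)" and "u \<in> S" "v \<in> S"
  shows "f u + grad f u \<bullet> (v - u) \<le> f v"
proof -
  have "\<forall>\<^sub>F t in at_right 0. (f (u + t *\<^sub>R (v - u)) - f u) / t \<le> f v - f u"
    using eventually_at_right_unit
  proof eventually_elim
    case (elim t)
    have "f ((1 - t) *\<^sub>R u + t *\<^sub>R v) \<le> (1 - t) * f u + t * f v"
      using elim assms by (intro convex_onD[OF cvx]) auto
    moreover have "(1 - t) *\<^sub>R u + t *\<^sub>R v = u + t *\<^sub>R (v - u)" by (simp add: algebra_simps)
    ultimately have "f (u + t *\<^sub>R (v - u)) - f u \<le> t * (f v - f u)"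
      by (simp add: left_diff_distrib right_diff_distrib)
    then show ?case using elim by (simp add: divide_le_eq mult.commute)
  qed
  from tendsto_upperbound[OF directional_derivative[OF diff] this] show ?thesis by simp
qed

lemma constrained_min_gradient_nonneg:
  fixes f :: "'a::euclidean_space \<Rightarrow> real"
  assumes "convex S" and diff: "f differentiable (at u)" and "u \<in> S" "v \<in> S"
    and min: "\<And>z. z \<in> S \<Longrightarrow> f u \<le> f z"
  shows "0 \<le> grad f u \<bullet> (v - u)"
proof -
  have "\<forall>\<^sub>F t in at_right 0. 0 \<le> (f (u + t *\<^sub>R (v - u)) - f u) / t"
    using eventually_at_right_unit
  proof eventually_elim
    case (elim t)
    have "(1 - t) *\<^sub>R u + t *\<^sub>R v \<in> S"
      using assms elim by (intro convexD) auto
    moreover have "(1 - t) *\<^sub>R u + t *\<^sub>R v = u + t *\<^sub>R (v - u)" by (simp add: algebra_simps)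
    ultimately show ?case using elim min by simp
  qed
  from tendsto_lowerbound[OF directional_derivative[OF diff] this] show ?thesis by simp
qed

section \<open>Strong convexity\<close>

lemma strongly_convex_on_midpoint:
  assumes "strongly_convex_on N m S f" "u \<in> S" "v \<in> S"
  shows "f ((1/2) *\<^sub>R u + (1/2) *\<^sub>R v) \<le> (f u + f v) / 2 - m / 8 * (N (v - u))\<^sup>2"
proof -
  have "\<forall>t\<in>{0..1}. f ((1 - t) *\<^sub>R u + t *\<^sub>R v)
          \<le> (1 - t) * f u + t * f v - m / 2 * t * (1 - t) * (N (v - u))\<^sup>2"
    using assms unfolding strongly_convex_on_def by blast
  from bspec[OF this, of "1/2"] show ?thesis by (simp add: field_simps)
qed

text \<open>The growth comes from comparing the midpoint of \<open>u\<close> and \<open>v\<close>, where \<open>f\<close> is at least its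
  minimum, with the strong convexity bound there.\<close>

lemma strongly_convex_min_growth:
  assumes sc: "strongly_convex_on N m S f" and "convex X" "X \<subseteq> S" "u \<in> X" "v \<in> X"
    and min: "\<And>z. z \<in> X \<Longrightarrow> f u \<le> f z"
  shows "m / 4 * (N (v - u))\<^sup>2 \<le> f v - f u"
proof -
  have "(1/2) *\<^sub>R u + (1/2) *\<^sub>R v \<in> X"
    using assms by (intro convexD) auto
  from min[OF this] have "f u \<le> (f u + f v) / 2 - m / 8 * (N (v - u))\<^sup>2"
    using strongly_convex_on_midpoint[OF sc, of u v] \<open>X \<subseteq> S\<close> \<open>u \<in> X\<close> \<open>v \<in> X\<close>
    by (meson order_trans subsetD)
  then show ?thesis by (simp add: field_simps)
qed

text \<open>The gradient inequality at the midpoint of \<open>u\<close> and \<open>v\<close>, compared with strong convexity there,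
  gives \<open>bregman f u v \<ge> m / 4 * (N (v - u))\<^sup>2\<close>.\<close>

lemma strongly_convex_bregman_pos:
  fixes f :: "'a::euclidean_space \<Rightarrow> real"
  assumes sc: "strongly_convex_on N m S f" and "m > 0" and N: "is_norm N"
    and cvx: "convex_on S f" and diff: "f differentiable (at u)"
    and uv: "u \<in> S" "v \<in> S" "u \<noteq> v"
  shows "0 < bregman f u v"
proof -
  let ?w = "(1/2) *\<^sub>R u + (1/2) *\<^sub>R v"
  have w: "?w \<in> S"
    using sc uv unfolding strongly_convex_on_def by (intro convexD) auto
  have "u = (1/2) *\<^sub>R u + (1/2) *\<^sub>R u" by (simp flip: scaleR_left_distrib)
  then have "?w - u = (1/2) *\<^sub>R (v - u)"
    by (metis add_diff_cancel_left scaleR_right_diff_distrib)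
  then have "f u + (grad f u \<bullet> (v - u)) / 2 \<le> f ?w"
    using convex_gradient_inequality[OF cvx diff uv(1) w] by simp
  also have "\<dots> \<le> (f u + f v) / 2 - m / 8 * (N (v - u))\<^sup>2"
    by (rule strongly_convex_on_midpoint[OF sc uv(1,2)])
  finally have "m / 4 * (N (v - u))\<^sup>2 \<le> bregman f u v"
    by (simp add: bregman_def field_simps)
  moreover have "N (v - u) \<noteq> 0" using N uv(3) unfolding is_norm_def by auto
  then have "0 < m / 4 * (N (v - u))\<^sup>2" using \<open>m > 0\<close> by simp
  ultimately show ?thesis by linarith
qed

lemma convex_on_add_norm_square_strongly_convex:
  fixes f :: "'a::real_inner \<Rightarrow> real"
  assumes "convex_on UNIV f"
  shows "strongly_convex_on norm (2 * e) UNIV (\<lambda>x. f x + e * (norm x)\<^sup>2)"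
  unfolding strongly_convex_on_def
proof (intro conjI ballI)
  fix u v :: 'a and t :: real
  assume t: "t \<in> {0..1}"
  have le: "f ((1 - t) *\<^sub>R u + t *\<^sub>R v) \<le> (1 - t) * f u + t * f v"
    using t by (intro convex_onD[OF assms]) auto
  have eq: "(norm ((1 - t) *\<^sub>R u + t *\<^sub>R v))\<^sup>2
      = (1 - t) * (norm u)\<^sup>2 + t * (norm v)\<^sup>2 - t * (1 - t) * (norm (v - u))\<^sup>2"
    by (simp add: power2_norm_eq_inner inner_add inner_diff inner_commute algebra_simps)
  from le show "f ((1 - t) *\<^sub>R u + t *\<^sub>R v) + e * (norm ((1 - t) *\<^sub>R u + t *\<^sub>R v))\<^sup>2
      \<le> (1 - t) * (f u + e * (norm u)\<^sup>2) + t * (f v + e * (norm v)\<^sup>2)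
         - 2 * e / 2 * t * (1 - t) * (norm (v - u))\<^sup>2"
    unfolding eq by (simp add: algebra_simps)
qed auto

lemma is_arg_max_linorder:
  fixes f :: "'a \<Rightarrow> 'b::linorder"
  shows "is_arg_max f P x \<longleftrightarrow> P x \<and> (\<forall>y. P y \<longrightarrow> f y \<le> f x)"
  by (auto simp: is_arg_max_def not_less)

section \<open>Existence of minimisers\<close>

text \<open>For \<open>v\<close> outside the unit ball, strong convexity along the segment from \<open>0\<close> to \<open>v\<close> is evaluated at
  the point of norm \<open>1\<close>, where \<open>f\<close> is bounded below by compactness; the quadratic term is then
  \<open>m / 2 * (norm v - 1)\<close>, which bounds \<open>norm v\<close>.\<close>

lemma strongly_convex_bounded_sublevel:
  fixes f :: "'a::euclidean_space \<Rightarrow> real"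
  assumes sc: "strongly_convex_on norm m UNIV f" and "m > 0" and cont: "continuous_on UNIV f"
  shows "bounded {x. f x \<le> a}"
proof -
  have "compact (f ` cball 0 1)"
    by (intro compact_continuous_image continuous_on_subset[OF cont]) auto
  then obtain b where b: "\<And>x. norm x \<le> 1 \<Longrightarrow> \<bar>f x\<bar> \<le> b"
    by (metis bounded_iff compact_imp_bounded image_eqI mem_cball_0 real_norm_def)
  have "norm v \<le> max 1 (1 + 2 / m * (\<bar>f 0\<bar> + \<bar>a\<bar> + b))" if "f v \<le> a" for v
  proof (cases "norm v \<le> 1")
    case False
    define t where "t = 1 / norm v"
    have t: "0 < t" "t < 1" "t * norm v = 1" using False by (auto simp: t_def divide_simps)
    have "f ((1 - t) *\<^sub>R 0 + t *\<^sub>R v)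
        \<le> (1 - t) * f 0 + t * f v - m / 2 * t * (1 - t) * (norm (v - 0))\<^sup>2"
      using sc t(1,2) unfolding strongly_convex_on_def by (metis UNIV_I atLeastAtMost_iff less_imp_le)
    moreover have "- b \<le> f (t *\<^sub>R v)" using b[of "t *\<^sub>R v"] t by simp
    moreover have "(1 - t) * f 0 \<le> \<bar>f 0\<bar>"
      using t mult_mono[of "1 - t" 1 "f 0" "\<bar>f 0\<bar>"]
      by (smt (verit) mult_left_le_one_le mult_less_0_iff zero_le_mult_iff)
    moreover have "t * f v \<le> \<bar>a\<bar>"
      using t that by (smt (verit) mult_left_le_one_le mult_left_mono mult_nonneg_nonpos)
    moreover have "m / 2 * t * (1 - t) * (norm (v - 0))\<^sup>2 = m / 2 * (norm v - 1)"
    proof -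
      have "m / 2 * t * (1 - t) * (norm (v - 0))\<^sup>2 = m / 2 * (t * norm v) * (norm v - t * norm v)"
        by (simp add: power2_eq_square algebra_simps)
      then show ?thesis using t(3) by simp
    qed
    ultimately have "m / 2 * (norm v - 1) \<le> \<bar>f 0\<bar> + \<bar>a\<bar> + b"
      using \<open>f ((1 - t) *\<^sub>R 0 + t *\<^sub>R v) \<le> _\<close> by (simp only: scaleR_zero_right add_0)
    then have "norm v \<le> 1 + 2 / m * (\<bar>f 0\<bar> + \<bar>a\<bar> + b)" using \<open>m > 0\<close> by (simp add: field_simps)
    then show ?thesis by simp
  qed simp
  then show ?thesis unfolding bounded_iff by blast
qed

lemma compact_sublevel:
  fixes f :: "'a::euclidean_space \<Rightarrow> real"
  assumes "closed S" and cont: "continuous_on UNIV f"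
    and "bounded S \<or> (\<exists>m>0. strongly_convex_on norm m UNIV f)"
  shows "compact {x\<in>S. f x \<le> a}"
proof -
  have "closed {x. f x \<le> a}"
    using cont by (intro closed_Collect_le) auto
  then have "closed (S \<inter> {x. f x \<le> a})" using \<open>closed S\<close> by (rule closed_Int[rotated])
  moreover have "bounded (S \<inter> {x. f x \<le> a})"
    using assms(3) strongly_convex_bounded_sublevel[OF _ _ cont]
    by (meson bounded_Int)
  ultimately show ?thesis by (simp add: compact_eq_bounded_closed Int_def)
qed

text \<open>The nonempty sublevel sets form a chain of compact sets, and any point common to all of them is a
  minimiser. Stated through sublevel sets, the result also covers the dual function, whose
  semicontinuity comes only from being an infimum of continuous functions.\<close>

lemma attains_min_of_compact_sublevels:
  fixes f :: "'a::t2_space \<Rightarrow> real"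
  assumes "S \<noteq> {}" and comp: "\<And>a. compact {x\<in>S. f x \<le> a}"
  obtains x where "x \<in> S" "\<And>y. y \<in> S \<Longrightarrow> f x \<le> f y"
proof -
  obtain z where z: "z \<in> S" using assms by blast
  let ?K = "\<lambda>a. {x\<in>S. f x \<le> a}"
  have "?K (f z) \<inter> \<Inter>(?K ` f ` S) \<noteq> {}"
  proof (rule compact_imp_fip)
    show "compact (?K (f z))" by (rule comp)
    show "closed T" if "T \<in> ?K ` f ` S" for T
      using that comp compact_imp_closed by blast
    fix F assume F: "finite F" "F \<subseteq> ?K ` f ` S"
    obtain B where "B \<subseteq> f ` S" "finite B" "F = ?K ` B"
      using finite_subset_image[OF F] by blast
    moreover obtain A where "A \<subseteq> S" "finite A" "B = f ` A"
      using finite_subset_image[OF \<open>finite B\<close> \<open>B \<subseteq> f ` S\<close>] by blast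
    ultimately have A: "A \<subseteq> S" "finite A" "F = ?K ` f ` A" by blast+
    let ?B = "f ` insert z A"
    have "Min ?B \<in> ?B" using A by (intro Min_in) auto
    then obtain w where w: "w \<in> insert z A" "f w = Min ?B" by force
    have "f w \<le> f y" if "y \<in> insert z A" for y
      unfolding w(2) using that A by (intro Min_le) auto
    then have "w \<in> ?K (f z) \<inter> \<Inter>F" using A z w(1) by auto
    then show "?K (f z) \<inter> \<Inter>F \<noteq> {}" by blast
  qed
  then show thesis using that by blast
qed

section \<open>Strong duality\<close>

lemma dual_fun_eq_min:
  assumes "x \<in> X" "\<And>x'. x' \<in> X \<Longrightarrow> F x y \<le> F x' y"
  shows "dual_fun F X y = F x y"
  unfolding dual_fun_def using assms by (intro cInf_eq_minimum) auto

lemma primal_fun_eq_max: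
  assumes "y \<in> Y" "\<And>y'. y' \<in> Y \<Longrightarrow> F x y' \<le> F x y"
  shows "primal_fun F Y x = F x y"
  unfolding primal_fun_def using assms by (intro cSup_eq_maximum) auto

text \<open>Let \<open>xs\<close> minimise \<open>F _ ys\<close>, and for small \<open>t\<close> let \<open>x\<close> minimise \<open>F _ z\<close> where
  \<open>z = (1 - t) ys + t y\<close>. Concavity and maximality of \<open>ys\<close> give
  \<open>(1 - t) * F x ys + t * F x y \<le> F x z \<le> F xs ys\<close>. Bounding \<open>F x ys\<close> below by \<open>F xs ys\<close> leaves
  \<open>F x y \<le> F xs ys\<close>; bounding \<open>F x y\<close> below by its minimum shows that \<open>F x ys\<close> exceeds the minimum
  \<open>F xs ys\<close> by \<open>O(t)\<close>, so strong convexity forces \<open>x\<close> to tend to \<open>xs\<close>. The limit of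
  \<open>F x y \<le> F xs ys\<close> is the claim.\<close>

lemma saddle_of_strongly_convex:
  fixes F :: "'a::euclidean_space \<Rightarrow> 'b::real_vector \<Rightarrow> real"
  assumes "convex X" "convex Y" and ys: "ys \<in> Y"
    and attained: "\<And>y. y \<in> Y \<Longrightarrow> \<exists>x\<in>X. \<forall>x'\<in>X. F x y \<le> F x' y"
    and sc: "strongly_convex_on norm m UNIV (\<lambda>x. F x ys)" "m > 0"
    and cont: "\<And>y. continuous_on UNIV (\<lambda>x. F x y)"
    and conc: "\<And>x. concave_on UNIV (F x)"
    and max: "\<And>y. y \<in> Y \<Longrightarrow> dual_fun F X y \<le> dual_fun F X ys"
  shows "\<exists>xs\<in>X. \<forall>y\<in>Y. F xs y \<le> dual_fun F X ys"
proof -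
  obtain xs where xs: "xs \<in> X" "\<And>x. x \<in> X \<Longrightarrow> F xs ys \<le> F x ys"
    using attained[OF ys] by blast
  have \<phi>s: "dual_fun F X ys = F xs ys" using xs by (intro dual_fun_eq_min) auto
  have "F xs y \<le> F xs ys" if y: "y \<in> Y" for y
  proof -
    \<comment> \<open>Chosen so that \<open>t n / (1 - t n)\<close> is exactly \<open>1 / Suc n\<close>.\<close>
    define t :: "nat \<Rightarrow> real" where "t n = 1 / (real n + 2)" for n
    define z where "z n = (1 - t n) *\<^sub>R ys + t n *\<^sub>R y" for n
    have t: "0 < t n" "t n < 1" for n by (auto simp: t_def)
    have z: "z n \<in> Y" for n
      unfolding z_def using t[of n] y ys \<open>convex Y\<close> by (intro convexD) auto
    have "\<exists>x. x \<in> X \<and> (\<forall>x'\<in>X. F x (z n) \<le> F x' (z n))" for n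
      using attained[OF z[of n]] by blast
    then obtain x where x: "\<And>n. x n \<in> X" "\<And>n x'. x' \<in> X \<Longrightarrow> F (x n) (z n) \<le> F x' (z n)"
      by metis
    obtain p where p: "p \<in> X" "\<And>x'. x' \<in> X \<Longrightarrow> F p y \<le> F x' y" using attained[OF y] by blast
    have key: "(1 - t n) * F (x n) ys + t n * F (x n) y \<le> F xs ys" for n
    proof -
      have "(1 - t n) * F (x n) ys + t n * F (x n) y \<le> F (x n) (z n)"
        unfolding z_def using t[of n] conc[of "x n"]
        by (intro concave_onD[OF conc]) auto
      also have "\<dots> = dual_fun F X (z n)" using x by (intro dual_fun_eq_min[symmetric]) auto
      also have "\<dots> \<le> F xs ys" using max[OF z] \<phi>s by simp
      finally show ?thesis .
    qed
    have le: "F (x n) y \<le> F xs ys" for n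
    proof -
      have "(1 - t n) * F xs ys \<le> (1 - t n) * F (x n) ys"
        using t[of n] xs(2)[OF x(1)] by (intro mult_left_mono) auto
      with key[of n] have "t n * F (x n) y \<le> t n * F xs ys" by (simp add: algebra_simps)
      then show ?thesis using t[of n] by simp
    qed
    have dist: "(norm (x n - xs))\<^sup>2 \<le> 4 / m * (F xs ys - F p y) * (1 / real (Suc n))" for n
    proof -
      have "t n * F p y \<le> t n * F (x n) y"
        using t[of n] p(2)[OF x(1)] by (intro mult_left_mono) auto
      with key[of n] have "(1 - t n) * (F (x n) ys - F xs ys) \<le> t n * (F xs ys - F p y)"
        by (simp add: algebra_simps)
      moreover have "t n = (1 - t n) * (1 / real (Suc n))" by (simp add: t_def field_simps)
      ultimately have "(1 - t n) * (F (x n) ys - F xs ys)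
          \<le> (1 - t n) * ((F xs ys - F p y) * (1 / real (Suc n)))"
        by (metis mult.assoc mult.commute)
      then have "F (x n) ys - F xs ys \<le> (F xs ys - F p y) * (1 / real (Suc n))"
        using t[of n] by (simp only: mult_le_cancel_left_pos diff_gt_0_iff_gt)
      moreover have "m / 4 * (norm (x n - xs))\<^sup>2 \<le> F (x n) ys - F xs ys"
        using strongly_convex_min_growth[OF sc(1) \<open>convex X\<close>, of xs "x n"] xs x by auto
      ultimately have "m / 4 * (norm (x n - xs))\<^sup>2 \<le> (F xs ys - F p y) * (1 / real (Suc n))" by linarith
      then have "4 / m * (m / 4 * (norm (x n - xs))\<^sup>2)
          \<le> 4 / m * ((F xs ys - F p y) * (1 / real (Suc n)))"
        using \<open>m > 0\<close> by (intro mult_left_mono) auto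
      then show ?thesis using \<open>m > 0\<close> by simp
    qed
    have "(\<lambda>n. 4 / m * (F xs ys - F p y) * (1 / real (Suc n))) \<longlonglongrightarrow> 4 / m * (F xs ys - F p y) * 0"
      by (rule tendsto_mult_left[OF LIMSEQ_Suc[OF lim_1_over_n]])
    then have "(\<lambda>n. 4 / m * (F xs ys - F p y) * (1 / real (Suc n))) \<longlonglongrightarrow> 0" by simp
    from tendsto_sandwich[OF _ _ tendsto_const this, of "\<lambda>n. (norm (x n - xs))\<^sup>2"]
    have "(\<lambda>n. (norm (x n - xs))\<^sup>2) \<longlonglongrightarrow> 0" using dist by simp
    from tendsto_real_sqrt[OF this] have "(\<lambda>n. norm (x n - xs)) \<longlonglongrightarrow> 0" by simp
    then have "x \<longlonglongrightarrow> xs" by (rule LIM_zero_cancel[OF tendsto_norm_zero_cancel])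
    then have "(\<lambda>n. F (x n) y) \<longlonglongrightarrow> F xs y"
      using cont[of y] by (intro isCont_tendsto_compose[where g = "\<lambda>x. F x y"])
        (auto simp: continuous_on_eq_continuous_at)
    then show ?thesis using le by (intro LIMSEQ_le_const2) auto
  qed
  then show ?thesis using xs(1) \<phi>s by auto
qed

context dual_extraction_setup
begin

lemma continuous_psi_right: "continuous_on A (\<psi> x)"
  using differentiable_psi[of x]
  by (meson continuous_at_imp_continuous_on differentiable_imp_continuous_within)

lemma continuous_psi_left: "continuous_on A (\<lambda>x. \<psi> x y)"
  by (rule continuous_on_subset[OF convex_on_continuous[OF open_UNIV convex_psi]]) simp

lemma inner_max_attained: "\<exists>y\<in>Y. \<forall>y'\<in>Y. \<psi> x y' \<le> \<psi> x y"
proof -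
  have "compact {y\<in>Y. - \<psi> x y \<le> a}" for a
    using bounded_Y_or
    by (intro compact_sublevel closed_Y continuous_on_minus continuous_psi_right) auto
  then obtain y where "y \<in> Y" "\<And>y'. y' \<in> Y \<Longrightarrow> - \<psi> x y \<le> - \<psi> x y'"
    by (rule attains_min_of_compact_sublevels[OF Y_nonempty]) blast
  then show ?thesis by auto
qed

lemma inner_min_attained: "\<exists>x\<in>X. \<forall>x'\<in>X. \<psi> x y \<le> \<psi> x' y"
proof -
  have "compact {x\<in>X. \<psi> x y \<le> a}" for a
    using bounded_X_or by (intro compact_sublevel closed_X continuous_psi_left) auto
  then obtain x where "x \<in> X" "\<And>x'. x' \<in> X \<Longrightarrow> \<psi> x y \<le> \<psi> x' y"
    by (rule attains_min_of_compact_sublevels[OF X_nonempty]) blast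
  then show ?thesis by auto
qed

lemma psi_le_primal_fun:
  assumes "y \<in> Y"
  shows "\<psi> x y \<le> primal_fun \<psi> Y x"
proof -
  obtain z where "z \<in> Y" "\<forall>y'\<in>Y. \<psi> x y' \<le> \<psi> x z" using inner_max_attained by blast
  then show ?thesis using assms primal_fun_eq_max[of z Y \<psi> x] by auto
qed

lemma primal_fun_le:
  assumes "\<And>y. y \<in> Y \<Longrightarrow> \<psi> x y \<le> c"
  shows "primal_fun \<psi> Y x \<le> c"
  unfolding primal_fun_def using assms Y_nonempty by (intro cSUP_least)

lemma dual_fun_le_psi:
  assumes "x \<in> X"
  shows "dual_fun \<psi> X y \<le> \<psi> x y"
proof -
  obtain z where "z \<in> X" "\<forall>x'\<in>X. \<psi> z y \<le> \<psi> x' y" using inner_min_attained by blast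
  then show ?thesis using assms dual_fun_eq_min[of z X \<psi> y] by auto
qed

text \<open>Adding \<open>e * (norm x)\<^sup>2\<close> makes \<open>\<psi>\<close> strongly convex in \<open>x\<close> at a cost of at most \<open>e * R\<^sup>2\<close> on \<open>X\<close>.
  The perturbed dual function has its own maximiser \<open>ye\<close>, which need not maximise the original
  one; this is why \<open>c\<close> is a bound on the dual function over all of \<open>Y\<close>.\<close>

lemma primal_le_dual_bound_plus_perturbation:
  assumes bdd: "bounded X" and "e > 0" and R: "\<And>x. x \<in> X \<Longrightarrow> norm x \<le> R"
    and max: "\<And>y. y \<in> Y \<Longrightarrow> dual_fun \<psi> X y \<le> c"
  shows "\<exists>x\<in>X. primal_fun \<psi> Y x \<le> c + e * R\<^sup>2"
proof -
  define F where "F x y = \<psi> x y + e * (norm x)\<^sup>2" for x y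
  have contF: "continuous_on A (\<lambda>x. F x y)" for A y
    unfolding F_def by (intro continuous_intros continuous_psi_left)
  have attained: "\<exists>x\<in>X. \<forall>x'\<in>X. F x y \<le> F x' y" for y
    using continuous_attains_inf[OF _ X_nonempty contF] bdd closed_X
    by (simp add: compact_eq_bounded_closed)
  have dual_ge: "a \<le> dual_fun F X y \<longleftrightarrow> (\<forall>x\<in>X. a \<le> F x y)" for a y
  proof -
    obtain z where "z \<in> X" "\<forall>x'\<in>X. F z y \<le> F x' y" using attained by blast
    then show ?thesis using dual_fun_eq_min[of z X F y] by force
  qed
  obtain x0 where x0: "x0 \<in> X" using X_nonempty by blast
  \<comment> \<open>The superlevel sets of an infimum are intersections of closed ones; the single point \<open>x0\<close>
    already confines them to a compact set.\<close>
  have "compact {y\<in>Y. - dual_fun F X y \<le> a}" for a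
  proof -
    have eq: "{y\<in>Y. - dual_fun F X y \<le> a}
        = {y\<in>Y. - \<psi> x0 y \<le> a + e * (norm x0)\<^sup>2} \<inter> (\<Inter>x\<in>X. {y. - a \<le> F x y})"
    proof (intro set_eqI)
      fix y
      have "- dual_fun F X y \<le> a \<longleftrightarrow> (\<forall>x\<in>X. - a \<le> F x y)"
        using dual_ge[of "- a" y] by linarith
      moreover have "- \<psi> x0 y \<le> a + e * (norm x0)\<^sup>2 \<longleftrightarrow> - a \<le> F x0 y"
        unfolding F_def by linarith
      ultimately show "y \<in> {y\<in>Y. - dual_fun F X y \<le> a} \<longleftrightarrow>
          y \<in> {y\<in>Y. - \<psi> x0 y \<le> a + e * (norm x0)\<^sup>2} \<inter> (\<Inter>x\<in>X. {y. - a \<le> F x y})"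
        using x0 by blast
    qed
    have "compact {y\<in>Y. - \<psi> x0 y \<le> a + e * (norm x0)\<^sup>2}"
      using bounded_Y_or
      by (intro compact_sublevel closed_Y continuous_on_minus continuous_psi_right) auto
    moreover have "closed (\<Inter>x\<in>X. {y. - a \<le> F x y})"
      unfolding F_def by (intro closed_INT ballI closed_Collect_le continuous_intros continuous_psi_right)
    ultimately show ?thesis unfolding eq by (rule compact_Int_closed)
  qed
  then obtain ye where "ye \<in> Y" "\<And>y. y \<in> Y \<Longrightarrow> - dual_fun F X ye \<le> - dual_fun F X y"
    by (rule attains_min_of_compact_sublevels[OF Y_nonempty]) blast
  then have ye: "ye \<in> Y" "\<And>y. y \<in> Y \<Longrightarrow> dual_fun F X y \<le> dual_fun F X ye" by auto
  have "\<exists>xe\<in>X. \<forall>y\<in>Y. F xe y \<le> dual_fun F X ye"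
  proof (rule saddle_of_strongly_convex[OF convex_X convex_Y ye(1)])
    show "strongly_convex_on norm (2 * e) UNIV (\<lambda>x. F x ye)"
      unfolding F_def by (rule convex_on_add_norm_square_strongly_convex[OF convex_psi])
    show "concave_on UNIV (F x)" for x
      unfolding F_def by (intro concave_on_add concave_psi) (simp add: concave_on_const)
  qed (use attained contF ye \<open>e > 0\<close> in auto)
  then obtain xe where xe: "xe \<in> X" "\<And>y. y \<in> Y \<Longrightarrow> F xe y \<le> dual_fun F X ye" by blast
  obtain p where p: "p \<in> X" "\<And>x. x \<in> X \<Longrightarrow> \<psi> p ye \<le> \<psi> x ye" using inner_min_attained by blast
  have "dual_fun F X ye \<le> F p ye" using p(1) dual_ge by blast
  also have "\<dots> \<le> c + e * R\<^sup>2"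
    using max[OF ye(1)] dual_fun_eq_min[of p X \<psi> ye] p R[OF p(1)] \<open>e > 0\<close>
    unfolding F_def by (intro add_mono mult_left_mono power_mono) auto
  finally have "dual_fun F X ye \<le> c + e * R\<^sup>2" .
  then have "\<psi> xe y \<le> c + e * R\<^sup>2" if "y \<in> Y" for y
    using xe(2)[OF that] \<open>e > 0\<close> unfolding F_def
    by (smt (verit) mult_nonneg_nonneg zero_le_power2)
  then show ?thesis using xe(1) primal_fun_le by blast
qed

lemma strong_duality:
  assumes xs: "is_arg_min (primal_fun \<psi> Y) (\<lambda>x. x \<in> X) xs"
    and ys: "is_arg_max (dual_fun \<psi> X) (\<lambda>y. y \<in> Y) ys"
  shows "primal_fun \<psi> Y xs \<le> dual_fun \<psi> X ys"
proof (cases "bounded X")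
  case True
  then obtain R where R: "R > 0" "\<And>x. x \<in> X \<Longrightarrow> norm x \<le> R" by (auto simp: bounded_pos)
  show ?thesis
  proof (rule field_le_epsilon)
    fix e :: real assume "e > 0"
    obtain x where "x \<in> X" "primal_fun \<psi> Y x \<le> dual_fun \<psi> X ys + e / R\<^sup>2 * R\<^sup>2"
      using primal_le_dual_bound_plus_perturbation[OF True, of "e / R\<^sup>2" R "dual_fun \<psi> X ys"] R \<open>e > 0\<close> ys
      by (auto simp: is_arg_max_linorder)
    moreover have "primal_fun \<psi> Y xs \<le> primal_fun \<psi> Y x"
      using xs \<open>x \<in> X\<close> by (auto simp: is_arg_min_linorder)
    ultimately show "primal_fun \<psi> Y xs \<le> dual_fun \<psi> X ys + e" using R(1) by simp
  qed
next
  case False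
  then obtain m where m: "m > 0" "strongly_convex_on norm m UNIV (\<lambda>x. \<psi> x ys)"
    using bounded_X_or by blast
  have "\<exists>x\<in>X. \<forall>y\<in>Y. \<psi> x y \<le> dual_fun \<psi> X ys"
  proof (rule saddle_of_strongly_convex[where F = \<psi>, OF convex_X convex_Y])
    show "strongly_convex_on norm m UNIV (\<lambda>x. \<psi> x ys)" by (rule m(2))
  qed (use ys m(1) inner_min_attained continuous_psi_left concave_psi in
      \<open>auto simp: is_arg_max_linorder\<close>)
  then obtain x where x: "x \<in> X" "\<And>y. y \<in> Y \<Longrightarrow> \<psi> x y \<le> dual_fun \<psi> X ys" by blast
  have "primal_fun \<psi> Y xs \<le> primal_fun \<psi> Y x"
    using xs x(1) by (auto simp: is_arg_min_linorder)
  also have "\<dots> \<le> dual_fun \<psi> X ys" using x(2) by (rule primal_fun_le)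
  finally show ?thesis .
qed

end

section \<open>The feasible set avoids the frontier\<close>

text \<open>At a point \<open>u\<close> of the segment, the gradient inequality for \<open>r\<close> tested against the ball of radius
  \<open>d\<close> around \<open>y0\<close> gives \<open>d * norm (grad r u) \<le> M - r u - grad r u \<bullet> (y0 - u)\<close>, which is
  \<open>bregman r u y0\<close> up to the constant \<open>M - r y0\<close>. Relative strong convexity bounds that divergence
  by the one of \<open>g\<close>, and convexity of \<open>g\<close> bounds the latter by its value at the endpoint \<open>b\<close>.
  The point \<open>b\<close> may lie on the frontier of \<open>P\<close>, where \<open>r\<close> need not have a gradient.\<close>

lemma grad_bounded_along_segment:
  fixes g r :: "'a::euclidean_space \<Rightarrow> real"
  assumes "\<mu> > 0" and rel: "rel_strongly_convex_on r \<mu> S g"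
    and g: "convex_on UNIV g" "\<And>y. g differentiable (at y)"
    and r: "convex_on P r" "continuous_on P r" "\<And>u. u \<in> interior P \<Longrightarrow> r differentiable (at u)"
    and y0: "y0 \<in> S" "y0 \<in> interior P"
  obtains C where "\<And>t. 0 \<le> t \<Longrightarrow> t \<le> 1 \<Longrightarrow> b + t *\<^sub>R (y0 - b) \<in> S \<inter> interior P \<Longrightarrow>
    norm (grad r (b + t *\<^sub>R (y0 - b))) \<le> C"
proof -
  obtain d where d: "d > 0" "cball y0 d \<subseteq> P" using y0(2) mem_interior_cball by blast
  have "compact (r ` cball y0 d)"
    by (intro compact_continuous_image continuous_on_subset[OF r(2) d(2)]) auto
  then obtain M where M: "\<And>v. v \<in> cball y0 d \<Longrightarrow> r v \<le> M"
    by (metis bounded_has_Sup(1) compact_imp_bounded image_eqI empty_iff image_is_empty)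
  define h where "h = y0 - b"
  define C where "C = (\<mu> * (M - r y0) + g y0 - g b - grad g b \<bullet> h) / (\<mu> * d)"
  have "norm (grad r (b + t *\<^sub>R h)) \<le> C"
    if t: "0 \<le> t" "t \<le> 1" and u: "b + t *\<^sub>R h \<in> S" "b + t *\<^sub>R h \<in> interior P" for t
  proof -
    define u where "u = b + t *\<^sub>R h"
    have y0u: "y0 - u = (1 - t) *\<^sub>R h" by (simp add: u_def h_def algebra_simps)
    \<comment> \<open>The point of the ball at which the linearisation of \<open>r\<close> at \<open>u\<close> is largest.\<close>
    define q where "q = y0 + d *\<^sub>R sgn (grad r u)"
    have q: "q \<in> cball y0 d" using d(1) by (simp add: q_def dist_norm norm_sgn)
    have "grad r u \<bullet> sgn (grad r u) = norm (grad r u)"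
      by (cases "grad r u = 0") (auto simp: sgn_div_norm dot_square_norm power2_eq_square)
    then have "grad r u \<bullet> (q - u) = (1 - t) * (grad r u \<bullet> h) + d * norm (grad r u)"
    proof -
      have "q - u = (1 - t) *\<^sub>R h + d *\<^sub>R sgn (grad r u)" using y0u by (simp add: q_def algebra_simps)
      then show ?thesis using \<open>grad r u \<bullet> sgn (grad r u) = _\<close> by (simp add: inner_add_right)
    qed
    moreover have "r u + grad r u \<bullet> (q - u) \<le> r q"
      using u d(2) q interior_subset unfolding u_def[symmetric]
      by (intro convex_gradient_inequality[OF r(1)] r(3)) auto
    ultimately have 1: "d * norm (grad r u) \<le> M - r u - (1 - t) * (grad r u \<bullet> h)"
      using M[OF q] by linarith
    have 2: "\<mu> * (r y0 - r u - (1 - t) * (grad r u \<bullet> h)) \<le> g y0 - g u - (1 - t) * (grad g u \<bullet> h)"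
      using rel u(1) y0(1) y0u unfolding rel_strongly_convex_on_def u_def[symmetric]
      by (metis inner_scaleR_right)
    have gb: "g b + t * (grad g b \<bullet> h) \<le> g u"
      using convex_gradient_inequality[OF g(1) g(2), of b u] by (simp add: u_def)
    have gu: "g u - t * (grad g u \<bullet> h) \<le> g b"
      using convex_gradient_inequality[OF g(1) g(2), of u b] by (simp add: u_def)
    have mono: "(1 - t) * (grad g b \<bullet> h) \<le> (1 - t) * (grad g u \<bullet> h)"
    proof (cases "t = 0")
      case False
      have "t * (grad g b \<bullet> h) \<le> t * (grad g u \<bullet> h)" using gb gu by linarith
      then show ?thesis using False t by (intro mult_left_mono) auto
    qed (simp add: u_def)
    have "\<mu> * (d * norm (grad r u)) \<le> \<mu> * (M - r u - (1 - t) * (grad r u \<bullet> h))"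
      using 1 \<open>\<mu> > 0\<close> by simp
    also have "\<dots> = \<mu> * (M - r y0) + \<mu> * (r y0 - r u - (1 - t) * (grad r u \<bullet> h))"
      by (simp add: algebra_simps)
    also have "\<dots> \<le> \<mu> * (M - r y0) + g y0 - g b - grad g b \<bullet> h"
      using 2 gb mono by (simp add: algebra_simps)
    finally show ?thesis
      unfolding C_def u_def[symmetric] using \<open>\<mu> > 0\<close> d(1) by (simp add: field_simps)
  qed
  then show thesis using that[of C] unfolding h_def by blast
qed

context dual_extraction_setup
begin

text \<open>Steepness makes the gradient of \<open>r\<close> blow up along the segment from a frontier point of \<open>P\<close> in
  \<open>Y\<close> to an interior one, contrary to the bound just obtained.\<close>

lemma feasible_set_subset_interior:
  assumes "\<mu> > 0" and rel: "rel_strongly_convex_on r \<mu> (Y \<inter> interior P) (\<lambda>y. - \<psi> x y)"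
  shows "Y \<subseteq> interior P"
proof (rule ccontr)
  assume "\<not> Y \<subseteq> interior P"
  then obtain b where b: "b \<in> Y" "b \<notin> interior P" by blast
  have bP: "b \<in> P" using b(1) Y_subset_U U_subset_P by blast
  then have "b \<in> frontier P"
    using b(2) closure_subset by (auto simp: frontier_def)
  moreover have "\<not> U \<subseteq> interior P" using b Y_subset_U by blast
  ultimately have lim: "filterlim (\<lambda>u. norm (grad r u)) at_top (at b within interior P)"
    using steep by blast
  obtain y0 where y0: "y0 \<in> Y" "y0 \<in> interior P" using Y_int_P by blast
  let ?z = "\<lambda>t. b + t *\<^sub>R (y0 - b)"
  have z: "?z t \<in> Y \<inter> interior P" if "0 < t" "t < 1" for t
  proof -
    have "b - t *\<^sub>R (b - y0) \<in> interior P"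
      using mem_interior_convex_shrink[OF convex_P y0(2) bP] that by auto
    moreover have "(1 - t) *\<^sub>R b + t *\<^sub>R y0 \<in> Y"
      using that b(1) y0(1) by (intro convexD[OF convex_Y]) auto
    ultimately show ?thesis by (simp add: algebra_simps)
  qed
  have "convex_on UNIV (\<lambda>y. - \<psi> x y)" using concave_psi by (simp add: concave_on_def)
  then obtain C where C: "\<And>t. 0 \<le> t \<Longrightarrow> t \<le> 1 \<Longrightarrow> ?z t \<in> Y \<inter> interior P \<inter> interior P \<Longrightarrow>
      norm (grad r (?z t)) \<le> C"
    using grad_bounded_along_segment[OF \<open>\<mu> > 0\<close> rel _ differentiable_minus[OF differentiable_psi]
        convex_r continuous_r differentiable_r, of y0 b] y0
    by blast
  have "(?z \<longlongrightarrow> b) (at_right 0)"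
    by (rule tendsto_eq_intros refl | simp)+
  moreover have "\<forall>\<^sub>F t in at_right 0. ?z t \<in> interior P \<and> ?z t \<noteq> b"
    using eventually_at_right_unit by eventually_elim (use z b(2) in fastforce)
  ultimately have "filterlim ?z (at b within interior P) (at_right 0)"
    unfolding filterlim_at by (simp add: conj_commute)
  then have "filterlim (\<lambda>t. norm (grad r (?z t))) at_top (at_right 0)"
    by (rule filterlim_compose[OF lim])
  then have "\<forall>\<^sub>F t in at_right 0. norm (grad r (?z t)) > C"
    by (simp add: filterlim_at_top_dense)
  then have "\<forall>\<^sub>F t in at_right (0::real). False"
    using eventually_at_right_unit
  proof eventually_elim
    case (elim t)
    then show ?case using C[of t] z[of t] by fastforce
  qed
  then show False by simp
qed

lemma argmax_relative_growth:
  assumes rel: "rel_strongly_convex_on r \<mu> (Y \<inter> interior P) (\<lambda>y. - \<psi> x y)"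
    and u: "is_arg_max (\<psi> x) (\<lambda>y. y \<in> Y) u" "u \<in> interior P" and v: "v \<in> Y" "v \<in> interior P"
  shows "\<mu> * bregman r u v \<le> \<psi> x u - \<psi> x v"
proof -
  have uY: "u \<in> Y" and max: "\<And>y. y \<in> Y \<Longrightarrow> \<psi> x y \<le> \<psi> x u"
    using u(1) by (auto simp: is_arg_max_linorder)
  have "0 \<le> grad (\<lambda>y. - \<psi> x y) u \<bullet> (v - u)"
    using uY v(1) max
    by (intro constrained_min_gradient_nonneg[OF convex_Y differentiable_minus[OF differentiable_psi]]) auto
  moreover have "\<mu> * bregman r u v \<le> - \<psi> x v - (- \<psi> x u) - grad (\<lambda>y. - \<psi> x y) u \<bullet> (v - u)"
    using rel uY u(2) v unfolding rel_strongly_convex_on_def bregman_def by blast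
  ultimately show ?thesis by simp
qed

end

theorem lemma3:
  fixes \<psi> :: "real ^ 'd \<Rightarrow> real ^ 'n \<Rightarrow> real"
    and X :: "(real ^ 'd) set"
    and Y U P :: "(real ^ 'n) set"
    and N r :: "real ^ 'n \<Rightarrow> real"
    and x x_star :: "real ^ 'd"
    and y_star :: "real ^ 'n"
    and \<mu> :: real
  assumes "dual_extraction_setup \<psi> X Y U P N r"
    and "x \<in> X"
    and "\<mu> > 0"
    and "rel_strongly_convex_on r \<mu> (Y \<inter> interior P) (\<lambda>y. - \<psi> x y)"
    and "is_arg_min (primal_fun \<psi> Y) (\<lambda>x'. x' \<in> X) x_star"
    and "is_arg_max (dual_fun \<psi> X) (\<lambda>y. y \<in> Y) y_star"
  shows "(\<exists>!y_x. is_arg_max (\<psi> x) (\<lambda>y. y \<in> Y) y_x) \<and>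
    (\<forall>y_x. is_arg_max (\<psi> x) (\<lambda>y. y \<in> Y) y_x \<longrightarrow>
       y_x \<in> interior P \<and>
       bregman r y_x y_star \<le> (primal_fun \<psi> Y x - primal_fun \<psi> Y x_star) / \<mu>)"
proof -
  interpret dual_extraction_setup \<psi> X Y U P N r by fact
  let ?argmax = "is_arg_max (\<psi> x) (\<lambda>y. y \<in> Y)"
  note Y_int = feasible_set_subset_interior[OF assms(3,4)]
  have argmaxD: "y \<in> Y" "\<And>y'. y' \<in> Y \<Longrightarrow> \<psi> x y' \<le> \<psi> x y" if "?argmax y" for y
    using that by (auto simp: is_arg_max_linorder)
  note growth = argmax_relative_growth[OF assms(4)]
  have "\<exists>y. ?argmax y" using inner_max_attained[of x] by (auto simp: is_arg_max_linorder)
  moreover have "u = v" if uv: "?argmax u" "?argmax v" for u v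
  proof (rule ccontr)
    assume "u \<noteq> v"
    have mem: "u \<in> U \<inter> interior P" "v \<in> U \<inter> interior P"
      using argmaxD(1)[OF uv(1)] argmaxD(1)[OF uv(2)] Y_int Y_subset_U by auto
    obtain m where m: "m > 0" "strongly_convex_on N m (U \<inter> interior P) r"
      using strongly_convex_r by blast
    have "convex_on (U \<inter> interior P) r"
      using convex_on_subset[OF convex_r] m(2) interior_subset
      unfolding strongly_convex_on_def by blast
    from strongly_convex_bregman_pos[OF m(2,1) is_norm_N this differentiable_r mem \<open>u \<noteq> v\<close>]
    have "0 < \<mu> * bregman r u v" using mem assms(3) by simp
    also have "\<dots> \<le> \<psi> x u - \<psi> x v"
      using growth[OF uv(1)] mem argmaxD(1)[OF uv(2)] by blast
    also have "\<dots> \<le> 0" using argmaxD[OF uv(2)] argmaxD(1)[OF uv(1)] by simp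
    finally show False by simp
  qed
  moreover have "bregman r y y_star \<le> (primal_fun \<psi> Y x - primal_fun \<psi> Y x_star) / \<mu>"
    if y: "?argmax y" for y
  proof -
    have ys: "y_star \<in> Y" using assms(6) by (simp add: is_arg_max_linorder)
    have "\<mu> * bregman r y y_star \<le> \<psi> x y - \<psi> x y_star"
      using growth[OF y] argmaxD(1)[OF y] Y_int ys by blast
    also have "\<dots> \<le> primal_fun \<psi> Y x - dual_fun \<psi> X y_star"
      using psi_le_primal_fun[OF argmaxD(1)[OF y]] dual_fun_le_psi[OF assms(2)]
      by (intro diff_mono)
    also have "\<dots> \<le> primal_fun \<psi> Y x - primal_fun \<psi> Y x_star"
      using strong_duality[OF assms(5,6)] by simp
    finally show ?thesis using assms(3) by (simp add: field_simps)
  qed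
  ultimately show ?thesis using argmaxD(1) Y_int by blast
qed

end
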